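(* The groups $G(\mathcal T,\mathcal C_2,\rho(\delta))$ and $G(\mathcal O,\mathbf 1,\beta)$ are conjugate in $\mathrm U_2(\mathbb H)$.
   Context: $\mathbb H$ is the real quaternion algebra with units $i,j,k$, and $\mathbb S^3$ is the group of quaternions of norm $1$. $\mathrm U_2(\mathbb H)$ is the group of $2\times2$ quaternionic matrices $A$ with $A\overline A^{\top}=I$. For a finite subgroup $K$ of $\mathbb S^3$, $H\trianglelefteq K$ and $\varphi\in\mathrm{Aut}(K/H)$ with $\varphi^2=1$, $G(K,H,\varphi)\subset \mathrm U_2(\mathbb H)$ is the group of order $2|K||H|$ consisting of all matrices $\mathrm{diag}(\xi,\eta)$ with $\xi,\eta\in K$, $\varphi(H\xi)=H\eta$, together with their products with $\begin{pmatrix}0&1\\1&0\end{pmatrix}$. Here $\mathbf 1$ denotes the trivial group. Let $\varpi=\frac12(-1+i+j+k)$, $\gamma=\frac1{\sqrt2}(1+i)$, $\delta=\frac1{\sqrt2}(i-j)$; $\mathcal C_2=\{\pm1\}$, $\mathcal T=\langle i,j,\varpi\rangle$ (order 24), $\mathcal O=\langle i,j,\varpi,\gamma\rangle$ (order 48). If $\xi\in\mathbb S^3$ normalises $K$ and $H$, $\rho(\xi)$ is the automorphism $H\eta\mapsto H\xi\eta\xi^{-1}$ of $K/H$. $\beta$ is the automorphism of $\mathcal O$ with $\beta(\xi)=\xi$ for $\xi\in\mathcal T$ and $\beta(\xi)=-\xi$ for $\xi\in\mathcal O\setminus\mathcal T$. *)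

theory Defs
  imports "HOL-Analysis.Analysis" "HOL-Algebra.Coset" "HOL-Algebra.Generated_Groups"
begin

section \<open>The real quaternion algebra\<close>

codatatype quat = Quat (QRe: real) (QIm1: real) (QIm2: real) (QIm3: real)

lemma quat_eqI:
  "\<lbrakk>QRe x = QRe y; QIm1 x = QIm1 y; QIm2 x = QIm2 y; QIm3 x = QIm3 y\<rbrakk> \<Longrightarrow> x = y"
  by (rule quat.expand) simp

lemma quat_eq_iff:
  "x = y \<longleftrightarrow> QRe x = QRe y \<and> QIm1 x = QIm1 y \<and> QIm2 x = QIm2 y \<and> QIm3 x = QIm3 y"
  by (auto intro: quat_eqI)

instantiation quat :: real_vector
begin

primcorec zero_quat where
  "QRe 0 = 0" | "QIm1 0 = 0" | "QIm2 0 = 0" | "QIm3 0 = 0"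

primcorec plus_quat where
  "QRe (x + y) = QRe x + QRe y" | "QIm1 (x + y) = QIm1 x + QIm1 y"
| "QIm2 (x + y) = QIm2 x + QIm2 y" | "QIm3 (x + y) = QIm3 x + QIm3 y"

primcorec uminus_quat where
  "QRe (- x) = - QRe x" | "QIm1 (- x) = - QIm1 x"
| "QIm2 (- x) = - QIm2 x" | "QIm3 (- x) = - QIm3 x"

primcorec minus_quat where
  "QRe (x - y) = QRe x - QRe y" | "QIm1 (x - y) = QIm1 x - QIm1 y"
| "QIm2 (x - y) = QIm2 x - QIm2 y" | "QIm3 (x - y) = QIm3 x - QIm3 y"

primcorec scaleR_quat where
  "QRe (r *\<^sub>R x) = r * QRe x" | "QIm1 (r *\<^sub>R x) = r * QIm1 x"
| "QIm2 (r *\<^sub>R x) = r * QIm2 x" | "QIm3 (r *\<^sub>R x) = r * QIm3 x"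

instance
  by standard (auto simp: quat_eq_iff algebra_simps)

end

primcorec qi :: quat where "QRe qi = 0" | "QIm1 qi = 1" | "QIm2 qi = 0" | "QIm3 qi = 0"
primcorec qj :: quat where "QRe qj = 0" | "QIm1 qj = 0" | "QIm2 qj = 1" | "QIm3 qj = 0"
primcorec qk :: quat where "QRe qk = 0" | "QIm1 qk = 0" | "QIm2 qk = 0" | "QIm3 qk = 1"

primcorec qcnj :: "quat \<Rightarrow> quat" where
  "QRe (qcnj x) = QRe x" | "QIm1 (qcnj x) = - QIm1 x"
| "QIm2 (qcnj x) = - QIm2 x" | "QIm3 (qcnj x) = - QIm3 x"

instantiation quat :: real_normed_div_algebra
begin

primcorec one_quat where
  "QRe 1 = 1" | "QIm1 1 = 0" | "QIm2 1 = 0" | "QIm3 1 = 0"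

primcorec times_quat where
  "QRe (x * y) = QRe x * QRe y - QIm1 x * QIm1 y - QIm2 x * QIm2 y - QIm3 x * QIm3 y"
| "QIm1 (x * y) = QRe x * QIm1 y + QIm1 x * QRe y + QIm2 x * QIm3 y - QIm3 x * QIm2 y"
| "QIm2 (x * y) = QRe x * QIm2 y - QIm1 x * QIm3 y + QIm2 x * QRe y + QIm3 x * QIm1 y"
| "QIm3 (x * y) = QRe x * QIm3 y + QIm1 x * QIm2 y - QIm2 x * QIm1 y + QIm3 x * QRe y"

definition norm_quat :: "quat \<Rightarrow> real" where
  "norm x = sqrt ((QRe x)\<^sup>2 + (QIm1 x)\<^sup>2 + (QIm2 x)\<^sup>2 + (QIm3 x)\<^sup>2)"

definition inverse_quat :: "quat \<Rightarrow> quat" where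
  "inverse x = inverse ((norm x)\<^sup>2) *\<^sub>R qcnj x"

definition divide_quat :: "quat \<Rightarrow> quat \<Rightarrow> quat" where
  "x div y = x * inverse y" for x y :: quat

definition sgn_quat :: "quat \<Rightarrow> quat" where
  "sgn x = x /\<^sub>R norm x" for x :: quat

definition dist_quat :: "quat \<Rightarrow> quat \<Rightarrow> real" where
  "dist x y = norm (x - y)" for x y :: quat

definition uniformity_quat :: "(quat \<times> quat) filter" where
  "uniformity = (INF e\<in>{0<..}. principal {(x :: quat, y). dist x y < e})"

definition open_quat :: "quat set \<Rightarrow> bool" where
  "open U \<longleftrightarrow> (\<forall>x\<in>U. eventually (\<lambda>(x', y). x' = x \<longrightarrow> y \<in> U) uniformity)"
  for U :: "quat set"

instance
proof
  fix x y z :: quat and r s :: real and U :: "quat set"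
  show "x * y * z = x * (y * z)" "(x + y) * z = x * z + y * z" "x * (y + z) = x * y + x * z"
    "r *\<^sub>R x * y = r *\<^sub>R (x * y)" "x * r *\<^sub>R y = r *\<^sub>R (x * y)"
    by (simp_all add: quat_eq_iff algebra_simps)
  show "1 * x = x" "x * 1 = x" "(0::quat) \<noteq> 1"
    by (simp_all add: quat_eq_iff)
  have n2: "(norm u)\<^sup>2 = (QRe u)\<^sup>2 + (QIm1 u)\<^sup>2 + (QIm2 u)\<^sup>2 + (QIm3 u)\<^sup>2" for u :: quat
    by (simp add: norm_quat_def)
  have n0: "norm u = 0 \<longleftrightarrow> u = 0" for u :: quat
    by (simp add: norm_quat_def quat_eq_iff add_nonneg_eq_0_iff)
  show "norm x = 0 \<longleftrightarrow> x = 0" by (rule n0)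
  have cnj: "qcnj u * u = (norm u)\<^sup>2 *\<^sub>R 1" "u * qcnj u = (norm u)\<^sup>2 *\<^sub>R 1" for u :: quat
    unfolding n2 by (simp_all add: quat_eq_iff power2_eq_square algebra_simps)
  have sc: "(a *\<^sub>R u) * v = a *\<^sub>R (u * v)" "u * (a *\<^sub>R v) = a *\<^sub>R (u * v)" for a and u v :: quat
    by (simp_all add: quat_eq_iff algebra_simps)
  show "inverse x * x = 1" "x * inverse x = 1" if "x \<noteq> 0"
    using that n0[of x] by (simp_all add: inverse_quat_def sc cnj)
  show "x div y = x * inverse y" by (rule divide_quat_def)
  show "inverse (0::quat) = 0" by (simp add: inverse_quat_def quat_eq_iff)
  show "dist x y = norm (x - y)" by (rule dist_quat_def)
  show "sgn x = x /\<^sub>R norm x" by (rule sgn_quat_def)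
  show "uniformity = (INF e\<in>{0<..}. principal {(x :: quat, y). dist x y < e})"
    by (rule uniformity_quat_def)
  show "open U \<longleftrightarrow> (\<forall>x\<in>U. eventually (\<lambda>(x', y). x' = x \<longrightarrow> y \<in> U) uniformity)"
    by (rule open_quat_def)
  have pr: "norm u = norm ((QRe u, QIm1 u), (QIm2 u, QIm3 u))" for u :: quat
    by (simp add: norm_quat_def norm_Pair add.assoc)
  show "norm (x + y) \<le> norm x + norm y"
    using norm_triangle_ineq[of "((QRe x, QIm1 x), (QIm2 x, QIm3 x))"
        "((QRe y, QIm1 y), (QIm2 y, QIm3 y))"]
    by (simp add: pr)
  have "(norm (r *\<^sub>R x))\<^sup>2 = (\<bar>r\<bar> * norm x)\<^sup>2"
    by (simp add: n2 power_mult_distrib algebra_simps)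
  moreover have "norm u \<ge> 0" for u :: quat by (simp add: norm_quat_def)
  ultimately show "norm (r *\<^sub>R x) = \<bar>r\<bar> * norm x"
    by (metis abs_ge_zero mult_nonneg_nonneg power2_eq_imp_eq)
  have "(norm (x * y))\<^sup>2 = (norm x * norm y)\<^sup>2"
    by (simp add: n2 power_mult_distrib) (simp add: power2_eq_square algebra_simps)
  then show "norm (x * y) = norm x * norm y"
    by (metis \<open>\<And>u::quat. norm u \<ge> 0\<close> mult_nonneg_nonneg power2_eq_imp_eq)
qed

end

section \<open>The groups \<open>S\<^sup>3\<close> and \<open>U\<^sub>2(H)\<close>\<close>

definition S3 :: "quat monoid" where
  "S3 = \<lparr>carrier = sphere 0 1, mult = (*), one = 1\<rparr>"

lemma group_S3: "group S3"
proof (rule groupI)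
  fix x assume "x \<in> carrier S3"
  then show "\<exists>y\<in>carrier S3. y \<otimes>\<^bsub>S3\<^esub> x = \<one>\<^bsub>S3\<^esub>"
    by (intro bexI[of _ "inverse x"]) (auto simp: S3_def norm_inverse intro!: left_inverse)
qed (auto simp: S3_def norm_mult mult.assoc)

definition qadjoint :: "quat ^ 'n ^ 'm \<Rightarrow> quat ^ 'm ^ 'n" where
  "qadjoint A = (\<chi> i j. qcnj (A $ j $ i))"

definition U2H :: "(quat ^ 2 ^ 2) monoid" where
  "U2H = \<lparr>carrier = {A. A ** qadjoint A = mat 1}, mult = (**), one = mat 1\<rparr>"

lemma qcnj_mult: "qcnj (x * y) = qcnj y * qcnj x"
  by (simp add: quat_eq_iff algebra_simps)

lemma qcnj_add: "qcnj (x + y) = qcnj x + qcnj y"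
  by (simp add: quat_eq_iff)

lemma qcnj_simps [simp]: "qcnj (qcnj x) = x" "qcnj 0 = 0" "qcnj 1 = 1"
  by (simp_all add: quat_eq_iff)

lemma mult_qcnj: "x * qcnj x = (norm x)\<^sup>2 *\<^sub>R 1" "qcnj x * x = (norm x)\<^sup>2 *\<^sub>R 1"
  by (simp_all add: norm_quat_def quat_eq_iff power2_eq_square algebra_simps)

lemma qadjoint_mult:
  fixes A B :: "quat ^ 2 ^ 2"
  shows "qadjoint (A ** B) = qadjoint B ** qadjoint A"
  by (simp add: qadjoint_def vec_eq_iff matrix_matrix_mult_def sum_2 qcnj_mult qcnj_add)

lemma qadjoint_left_inverse:
  fixes A :: "quat ^ 2 ^ 2"
  assumes "A ** qadjoint A = mat 1"
  shows "qadjoint A ** A = mat 1"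
proof -
  define a b c d where "a = A $ 1 $ 1" "b = A $ 1 $ 2" "c = A $ 2 $ 1" "d = A $ 2 $ 2"
  note abcd = this
  define p q r s where "p = (norm a)\<^sup>2" "q = (norm b)\<^sup>2" "r = (norm c)\<^sup>2" "s = (norm d)\<^sup>2"
  note pqrs = this
  have e1: "a * qcnj a + b * qcnj b = 1" and e2: "c * qcnj c + d * qcnj d = 1"
    and e3: "a * qcnj c + b * qcnj d = 0"
    using assms unfolding abcd
    by (simp_all add: vec_eq_iff forall_2 qadjoint_def matrix_matrix_mult_def sum_2 mat_def)
  have pq: "p + q = 1" and rs: "r + s = 1"
    using e1 e2 unfolding pqrs mult_qcnj by (simp_all add: quat_eq_iff)
  have ncnj: "norm (qcnj x) = norm x" for x by (simp add: norm_quat_def)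
  have e3': "a * qcnj c = - (b * qcnj d)" using e3 by (simp add: eq_neg_iff_add_eq_0)
  then have "(norm (a * qcnj c))\<^sup>2 = (norm (b * qcnj d))\<^sup>2" by simp
  then have "p * r = q * s" by (simp add: pqrs norm_mult ncnj power_mult_distrib)
  moreover have "q = 1 - p" "s = 1 - r" using pq rs by simp_all
  ultimately have pr: "p + r = 1" by (simp add: algebra_simps)
  then have ps: "s = p" and qs: "q + s = 1" using pq rs by simp_all
  have f1: "qcnj a * a + qcnj c * c = 1" "qcnj b * b + qcnj d * d = 1"
    using pr qs unfolding mult_qcnj pqrs[symmetric] by (simp_all add: quat_eq_iff)
  have f2: "qcnj a * b + qcnj c * d = 0"
  proof (cases "p = 0")
    case True
    then have "a = 0" "d = 0" using ps by (auto simp: pqrs)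
    then show ?thesis by simp
  next
    case False
    have "(qcnj a * a) * qcnj c * d = - (qcnj a * b * (qcnj d * d))"
      using arg_cong[OF e3', of "\<lambda>x. qcnj a * x * d"] by (simp add: mult.assoc)
    then have "p *\<^sub>R (qcnj c * d) = - (p *\<^sub>R (qcnj a * b))"
      unfolding mult_qcnj pqrs[symmetric] ps by simp
    then have "p *\<^sub>R (qcnj a * b + qcnj c * d) = 0" by (simp add: scaleR_right_distrib)
    then show ?thesis using False by simp
  qed
  have f3: "qcnj b * a + qcnj d * c = 0"
    using arg_cong[OF f2, of qcnj] by (simp add: qcnj_add qcnj_mult)
  show ?thesis
    using f1 f2 f3 unfolding abcd
    by (simp add: vec_eq_iff forall_2 qadjoint_def matrix_matrix_mult_def sum_2 mat_def)
qed

lemma matrix_assoc_quat: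
  fixes A B C :: "quat ^ 2 ^ 2"
  shows "A ** B ** C = A ** (B ** C)"
  by (simp add: vec_eq_iff matrix_matrix_mult_def sum_2 algebra_simps)

lemma matrix_one_quat [simp]:
  fixes A :: "quat ^ 2 ^ 2"
  shows "mat 1 ** A = A" "A ** mat 1 = A"
  by (simp_all add: vec_eq_iff forall_2 matrix_matrix_mult_def sum_2 mat_def)

lemma qadjoint_qadjoint [simp]: "qadjoint (qadjoint A) = A"
  by (simp add: qadjoint_def vec_eq_iff)

lemma group_U2H: "group U2H"
proof (rule groupI)
  fix A B assume "A \<in> carrier U2H" "B \<in> carrier U2H"
  then have A: "A ** qadjoint A = mat 1" and B: "B ** qadjoint B = mat 1"
    by (simp_all add: U2H_def)
  have "A ** B ** qadjoint (A ** B) = A ** (B ** qadjoint B) ** qadjoint A"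
    by (simp only: qadjoint_mult matrix_assoc_quat)
  then show "A \<otimes>\<^bsub>U2H\<^esub> B \<in> carrier U2H" using A B by (simp add: U2H_def)
next
  fix A assume "A \<in> carrier U2H"
  then show "\<exists>B\<in>carrier U2H. B \<otimes>\<^bsub>U2H\<^esub> A = \<one>\<^bsub>U2H\<^esub>"
    by (intro bexI[of _ "qadjoint A"]) (auto simp: U2H_def qadjoint_left_inverse)
next
  show "\<one>\<^bsub>U2H\<^esub> \<in> carrier U2H"
    by (simp add: U2H_def vec_eq_iff forall_2 qadjoint_def mat_def matrix_matrix_mult_def sum_2)
qed (simp_all add: U2H_def matrix_assoc_quat)

definition conjugate_in :: "('a, 'm) monoid_scheme \<Rightarrow> 'a set \<Rightarrow> 'a set \<Rightarrow> bool" where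
  "conjugate_in G X Y \<longleftrightarrow> (\<exists>g\<in>carrier G. Y = g <#\<^bsub>G\<^esub> X #>\<^bsub>G\<^esub> inv\<^bsub>G\<^esub> g)"

section \<open>The groups \<open>G(K, H, \<phi>)\<close>\<close>

definition diag2 :: "quat \<Rightarrow> quat \<Rightarrow> quat ^ 2 ^ 2" where
  "diag2 \<xi> \<eta> = vector [vector [\<xi>, 0], vector [0, \<eta>]]"

definition swap2 :: "quat ^ 2 ^ 2" where
  "swap2 = vector [vector [0, 1], vector [1, 0]]"

text \<open>
  The map \<open>\<phi>\<close> is a function on the cosets \<open>H\<xi>\<close>, that is, on the carrier of
  \<open>S3\<lparr>carrier := K\<rparr> Mod H\<close>. The definition is meant for \<open>\<phi>\<close> an automorphism of that quotient
  with \<open>\<phi>\<^sup>2 = 1\<close>; multiplying by \<open>swap2\<close> from the left then gives the same set.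
\<close>
definition Ggrp :: "quat set \<Rightarrow> quat set \<Rightarrow> (quat set \<Rightarrow> quat set) \<Rightarrow> (quat ^ 2 ^ 2) set" where
  "Ggrp K H \<phi> =
     (let D = {diag2 \<xi> \<eta> | \<xi> \<eta>. \<xi> \<in> K \<and> \<eta> \<in> K \<and> \<phi> (H #>\<^bsub>S3\<^esub> \<xi>) = H #>\<^bsub>S3\<^esub> \<eta>}
      in D \<union> (\<lambda>A. A ** swap2) ` D)"

lemma diag2_nth [simp]:
  "diag2 a b $ 1 $ 1 = a" "diag2 a b $ 1 $ 2 = 0" "diag2 a b $ 2 $ 1 = 0" "diag2 a b $ 2 $ 2 = b"
  by (simp_all add: diag2_def)

lemma swap2_nth [simp]:
  "swap2 $ 1 $ 1 = 0" "swap2 $ 1 $ 2 = 1" "swap2 $ 2 $ 1 = 1" "swap2 $ 2 $ 2 = 0"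
  by (simp_all add: swap2_def)

lemma diag2_swap2_mult:
  "diag2 a b ** diag2 c d = diag2 (a * c) (b * d)"
  "diag2 a b ** (diag2 c d ** swap2) = diag2 (a * c) (b * d) ** swap2"
  "diag2 a b ** swap2 ** diag2 c d = diag2 (a * d) (b * c) ** swap2"
  "diag2 a b ** swap2 ** (diag2 c d ** swap2) = diag2 (a * d) (b * c)"
  by (simp_all add: vec_eq_iff forall_2 matrix_matrix_mult_def sum_2)

lemma qadjoint_diag2_swap2:
  "qadjoint (diag2 a b) = diag2 (qcnj a) (qcnj b)"
  "qadjoint (diag2 a b ** swap2) = diag2 (qcnj b) (qcnj a) ** swap2"
  by (simp_all add: vec_eq_iff forall_2 matrix_matrix_mult_def sum_2 qadjoint_def)

lemma mat_1_diag2: "mat 1 = diag2 1 1"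
  by (simp add: vec_eq_iff forall_2 mat_def)

lemma inv_S3: "x \<in> carrier S3 \<Longrightarrow> inv\<^bsub>S3\<^esub> x = qcnj x"
  by (rule group.inv_equality[OF group_S3])
    (auto simp: S3_def mult_qcnj, simp add: norm_quat_def)

lemma inv_U2H: "A \<in> carrier U2H \<Longrightarrow> inv\<^bsub>U2H\<^esub> A = qadjoint A"
  by (rule group.inv_equality[OF group_U2H]) (auto simp: U2H_def qadjoint_left_inverse)

lemma subgroup_Ggrp:
  fixes K H \<phi>
  defines "Q \<equiv> S3\<lparr>carrier := K\<rparr> Mod H"
  assumes K: "subgroup K S3" and H: "H \<lhd> S3\<lparr>carrier := K\<rparr>"
    and \<phi>: "\<phi> \<in> iso Q Q" and inv: "\<And>X. X \<in> carrier Q \<Longrightarrow> \<phi> (\<phi> X) = X"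
  shows "subgroup (Ggrp K H \<phi>) U2H"
proof -
  let ?S = "S3\<lparr>carrier := K\<rparr>"
  interpret N: normal H ?S by (rule H)
  interpret S: group S3 by (rule group_S3)
  have KS: "\<xi> \<in> carrier S3" if "\<xi> \<in> K" for \<xi> using K that by (rule subgroup.mem_carrier)
  define co where "co \<xi> = H #>\<^bsub>S3\<^esub> \<xi>" for \<xi>
  have co': "co \<xi> = H #>\<^bsub>?S\<^esub> \<xi>" for \<xi> by (simp add: co_def r_coset_def)
  have coQ: "co \<xi> \<in> carrier Q" if "\<xi> \<in> K" for \<xi>
    using that by (auto simp: Q_def FactGroup_def RCOSETS_def co')
  have com: "co (\<xi> * \<eta>) = co \<xi> \<otimes>\<^bsub>Q\<^esub> co \<eta>" if "\<xi> \<in> K" "\<eta> \<in> K" for \<xi> \<eta>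
    using that N.rcos_sum[of \<xi> \<eta>] by (simp add: Q_def FactGroup_def co' S3_def)
  have Q: "group Q" unfolding Q_def by (rule N.factorgroup_is_group)
  have hom: "\<phi> \<in> hom Q Q" using \<phi> by (simp add: iso_def)
  have Kc: "qcnj \<xi> \<in> K" if "\<xi> \<in> K" for \<xi>
    using subgroup.m_inv_closed[OF K that] inv_S3[OF KS[OF that]] by simp
  have Km: "\<xi> * \<eta> \<in> K" if "\<xi> \<in> K" "\<eta> \<in> K" for \<xi> \<eta>
    using subgroup.m_closed[OF K that] by (simp add: S3_def)
  have K1: "1 \<in> K" using subgroup.one_closed[OF K] by (simp add: S3_def)
  have Kn: "\<xi> * qcnj \<xi> = 1" "qcnj \<xi> * \<xi> = 1" if "\<xi> \<in> K" for \<xi>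
    using KS[OF that] by (simp_all add: S3_def mult_qcnj)
  have co1: "co 1 = \<one>\<^bsub>Q\<^esub>"
    using com[OF K1 K1] coQ[OF K1] group.l_cancel_one'[OF Q coQ[OF K1] coQ[OF K1]] by simp
  have coi: "co (qcnj \<xi>) = inv\<^bsub>Q\<^esub> co \<xi>" if "\<xi> \<in> K" for \<xi>
    using com[OF Kc[OF that] that] coQ[OF that] coQ[OF Kc[OF that]] Kn[OF that] co1
      group.inv_equality[OF Q] by metis
  define P where "P \<xi> \<eta> \<longleftrightarrow> \<xi> \<in> K \<and> \<eta> \<in> K \<and> \<phi> (co \<xi>) = co \<eta>" for \<xi> \<eta>
  have G: "Ggrp K H \<phi> = {diag2 \<xi> \<eta> | \<xi> \<eta>. P \<xi> \<eta>} \<union> {diag2 \<xi> \<eta> ** swap2 | \<xi> \<eta>. P \<xi> \<eta>}"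
    unfolding Ggrp_def P_def co_def Let_def by (rule arg_cong2[of _ _ _ _ "(\<union>)"]) blast+
  have Pm: "P (a * c) (b * d)" if "P a b" "P c d" for a b c d
    using that hom_mult[OF hom] by (auto simp: P_def com Km coQ)
  have Ps: "P b a" if "P a b" for a b
    using that inv[OF coQ] by (metis P_def)
  have Pc: "P (qcnj a) (qcnj b)" if "P a b" for a b
    using that Kc coQ coi group_hom.hom_inv[of Q Q \<phi>] Q hom
    by (auto simp: P_def group_hom_def group_hom_axioms_def)
  have P1: "P 1 1"
    using K1 co1 hom_one[OF hom Q Q] by (simp add: P_def)
  have sub: "A \<in> carrier U2H" if "A \<in> Ggrp K H \<phi>" for A
    using that Kn
    by (auto simp: G U2H_def qadjoint_diag2_swap2 diag2_swap2_mult mat_1_diag2 P_def)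
  show ?thesis
  proof (rule group.subgroupI[OF group_U2H])
    show "Ggrp K H \<phi> \<subseteq> carrier U2H" using sub by blast
    show "Ggrp K H \<phi> \<noteq> {}" using P1 by (auto simp: G)
    show "inv\<^bsub>U2H\<^esub> A \<in> Ggrp K H \<phi>" if "A \<in> Ggrp K H \<phi>" for A
      using that Pc Ps unfolding inv_U2H[OF sub[OF that]]
      by (auto simp: G qadjoint_diag2_swap2) blast+
    show "A \<otimes>\<^bsub>U2H\<^esub> B \<in> Ggrp K H \<phi>" if "A \<in> Ggrp K H \<phi>" "B \<in> Ggrp K H \<phi>" for A B
      using that Pm Ps unfolding G
      by (auto simp: U2H_def diag2_swap2_mult) blast+
  qed
qed

definition varpi :: quat where
  "varpi = (1 / 2) *\<^sub>R (- 1 + qi + qj + qk)"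

definition gamma :: quat where
  "gamma = (1 / sqrt 2) *\<^sub>R (1 + qi)"

definition delta :: quat where
  "delta = (1 / sqrt 2) *\<^sub>R (qi - qj)"

definition C2 :: "quat set" where
  "C2 = {1, - 1}"

definition Tgrp :: "quat set" where
  "Tgrp = generate S3 {qi, qj, varpi}"

definition Ogrp :: "quat set" where
  "Ogrp = generate S3 {qi, qj, varpi, gamma}"

text \<open>
  \<open>rho H \<xi>\<close> is the map \<open>H\<eta> \<mapsto> H\<xi>\<eta>\<xi>\<inverse>\<close>, with the union taken over all representatives \<open>\<eta>\<close>
  of the coset; when \<open>\<xi>\<close> normalises \<open>H\<close> they all contribute the same coset.
\<close>
definition rho :: "quat set \<Rightarrow> quat \<Rightarrow> quat set \<Rightarrow> quat set" where
  "rho H \<xi> X = (\<Union>\<eta>\<in>X. H #>\<^bsub>S3\<^esub> (\<xi> * \<eta> * inverse \<xi>))"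

text \<open>
  Only the values of \<open>beta\<close> on \<open>Ogrp\<close> matter. For \<open>H = {1}\<close> the elements of \<open>K / H\<close> are the
  singletons \<open>{\<xi>}\<close>, so an automorphism \<open>f\<close> of \<open>K\<close>, viewed as one of \<open>K / H\<close>, is \<open>image f\<close>.
\<close>
definition beta :: "quat \<Rightarrow> quat" where
  "beta \<xi> = (if \<xi> \<in> Tgrp then \<xi> else - \<xi>)"

end

theory Submission
  imports Defs
begin

text \<open>
  Conjugation by \<open>diag(1, \<delta>\<inverse>)\<close> turns \<open>G(T, C\<^sub>2, \<rho>(\<delta>))\<close> into the matrices
  \<open>diag(\<xi>, \<plusminus>\<xi>)\<close> with \<open>\<xi> \<in> T\<close>, together with their products with \<open>\<delta>\<close> times a real rotation
  by a right angle, because \<open>\<delta>\<^sup>2 = - 1\<close>. The real reflection with rows \<open>(1, 1)/\<surd>2\<close> and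
  \<open>(1, - 1)/\<surd>2\<close> exchanges \<open>diag(1, - 1)\<close> with the swap matrix and commutes with quaternion
  scalars; so after conjugating by it as well one gets \<open>diag(\<xi>, \<xi>)\<close> for \<open>\<xi> \<in> T\<close> and
  \<open>diag(\<xi>, - \<xi>)\<close> for \<open>\<xi> \<in> T\<delta>\<close>, and their products with the swap. Since \<open>O\<close> is the
  disjoint union of \<open>T\<close> and \<open>T\<delta>\<close>, this is \<open>G(O, 1, \<beta>)\<close>.
\<close>

section \<open>Coordinates of the constants and subgroups of the unit sphere\<close>

lemma quat_sel_delta [simp]:
  "QRe delta = 0" "QIm1 delta = 1 / sqrt 2" "QIm2 delta = - (1 / sqrt 2)" "QIm3 delta = 0"
  by (simp_all add: delta_def)

lemma quat_sel_varpi [simp]: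
  "QRe varpi = - (1 / 2)" "QIm1 varpi = 1 / 2" "QIm2 varpi = 1 / 2" "QIm3 varpi = 1 / 2"
  by (simp_all add: varpi_def)

lemma quat_sel_gamma [simp]:
  "QRe gamma = 1 / sqrt 2" "QIm1 gamma = 1 / sqrt 2" "QIm2 gamma = 0" "QIm3 gamma = 0"
  by (simp_all add: gamma_def)

lemma delta_square: "delta * delta = - 1"
  by (simp add: quat_eq_iff)

lemma inverse_delta: "inverse delta = - delta"
  by (rule inverse_unique) (simp add: delta_square)

lemma inverse_eq_qcnj: "norm x = 1 \<Longrightarrow> inverse x = qcnj x"
  by (simp add: inverse_quat_def)

lemma norm_qi [simp]: "norm qi = 1" and norm_qj [simp]: "norm qj = 1"
  and norm_varpi [simp]: "norm varpi = 1" and norm_gamma [simp]: "norm gamma = 1"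
  by (simp_all add: norm_quat_def power2_eq_square)

lemma S3_sel [simp]: "carrier S3 = sphere 0 1" "x \<otimes>\<^bsub>S3\<^esub> y = x * y" "\<one>\<^bsub>S3\<^esub> = 1"
  by (simp_all add: S3_def)

lemma inv_S3_eq_inverse: "norm x = 1 \<Longrightarrow> inv\<^bsub>S3\<^esub> x = inverse x"
  by (simp add: inv_S3 inverse_eq_qcnj)

lemma subgroup_S3D:
  assumes "subgroup K S3"
  shows "1 \<in> K" "x \<in> K \<Longrightarrow> norm x = 1" "x \<in> K \<Longrightarrow> y \<in> K \<Longrightarrow> x * y \<in> K"
    "x \<in> K \<Longrightarrow> inverse x \<in> K"
proof -
  show "1 \<in> K" "x \<in> K \<Longrightarrow> y \<in> K \<Longrightarrow> x * y \<in> K"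
    using subgroup.one_closed[OF assms] subgroup.m_closed[OF assms] by auto
  show n: "norm x = 1" if "x \<in> K"
    using subgroup.mem_carrier[OF assms that] by simp
  show "inverse x \<in> K" if "x \<in> K"
    using subgroup.m_inv_closed[OF assms that] n[OF that] by (simp add: inv_S3_eq_inverse)
qed

lemma subgroup_S3I:
  assumes "1 \<in> K" "\<And>x. x \<in> K \<Longrightarrow> norm x = 1" "\<And>x y. x \<in> K \<Longrightarrow> y \<in> K \<Longrightarrow> x * y \<in> K"
    "\<And>x. x \<in> K \<Longrightarrow> inverse x \<in> K"
  shows "subgroup K S3"
  by (rule group.subgroupI[OF group_S3]) (use assms in \<open>auto simp: inv_S3_eq_inverse\<close>)

section \<open>The group \<open>Tgrp\<close> and its coset by \<open>delta\<close>\<close>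

lemma subgroup_Tgrp: "subgroup Tgrp S3"
  unfolding Tgrp_def by (rule group.generate_is_subgroup[OF group_S3]) auto

lemma subgroup_Ogrp: "subgroup Ogrp S3"
  unfolding Ogrp_def by (rule group.generate_is_subgroup[OF group_S3]) auto

lemmas Tgrp_closed = subgroup_S3D[OF subgroup_Tgrp]
lemmas Ogrp_closed = subgroup_S3D[OF subgroup_Ogrp]

lemma Tgrp_gens: "qi \<in> Tgrp" "qj \<in> Tgrp" "varpi \<in> Tgrp"
  by (auto simp: Tgrp_def intro: generate.incl)

text \<open>Serves as an induction principle for \<open>Tgrp\<close>: a property is proved by
  showing that the unit quaternions having it form a subgroup containing the generators.\<close>

lemma Tgrp_least:
  assumes "subgroup K S3" "qi \<in> K" "qj \<in> K" "varpi \<in> K"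
  shows "Tgrp \<subseteq> K"
  unfolding Tgrp_def
  by (rule group.generate_subgroup_incl[OF group_S3 _ assms(1)]) (use assms in auto)

lemma Tgrp_uminus: "- x \<in> Tgrp \<longleftrightarrow> x \<in> Tgrp"
proof -
  have "qi * qi = - 1"
    by (simp add: quat_eq_iff)
  then have "- 1 \<in> Tgrp"
    using Tgrp_closed(3)[OF Tgrp_gens(1,1)] by simp
  then have "- y \<in> Tgrp" if "y \<in> Tgrp" for y
    using Tgrp_closed(3)[of "- 1" y] that by simp
  then show ?thesis
    by (metis minus_minus)
qed

text \<open>Conjugation by \<open>delta\<close> is multiplicative, so it suffices to look at
  generators: it sends \<open>qi\<close> to \<open>- qj\<close>, \<open>qj\<close> to
  \<open>- qi\<close> and \<open>varpi\<close> to its inverse.\<close>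

lemma delta_conj_Tgrp:
  assumes "x \<in> Tgrp"
  shows "delta * x * inverse delta \<in> Tgrp"
proof -
  let ?c = "\<lambda>x. delta * x * inverse delta"
  have d0: "delta \<noteq> 0"
    by (simp add: quat_eq_iff)
  let ?K = "{x. norm x = 1 \<and> ?c x \<in> Tgrp}"
  have mult: "?c (x * y) = ?c x * ?c y" for x y
    using d0 by (simp add: mult.assoc) (simp flip: mult.assoc)
  have inv: "?c (inverse x) = inverse (?c x)" if "norm x = 1" for x
  proof -
    have "x \<noteq> 0"
      using that by auto
    then show ?thesis
      using d0 by (simp add: nonzero_inverse_mult_distrib mult.assoc)
  qed
  have "subgroup ?K S3"
    using d0 by (intro subgroup_S3I)
      (auto simp: Tgrp_closed norm_mult norm_inverse mult inv simp del: mult_minus_right)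
  moreover have "?c qi = - qj" "?c qj = - qi"
    by (simp_all add: inverse_delta quat_eq_iff)
  moreover have "?c varpi = inverse varpi"
    by (simp add: inverse_delta inverse_eq_qcnj quat_eq_iff)
  ultimately have "Tgrp \<subseteq> ?K"
    by (intro Tgrp_least) (simp_all add: Tgrp_gens Tgrp_closed Tgrp_uminus)
  then show ?thesis
    using assms by blast
qed

text \<open>Unit quaternions with four rational coordinates form a subgroup, since inversion there
  is conjugation. This separates \<open>delta\<close>, with coordinate \<open>1 / sqrt 2\<close>,
  from \<open>Tgrp\<close>.\<close>

lemma Tgrp_rational_QIm1:
  assumes "x \<in> Tgrp"
  shows "QIm1 x \<in> \<rat>"
proof -
  let ?K = "{x. norm x = 1 \<and> QRe x \<in> \<rat> \<and> QIm1 x \<in> \<rat> \<and> QIm2 x \<in> \<rat> \<and> QIm3 x \<in> \<rat>}"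
  have "subgroup ?K S3"
    by (intro subgroup_S3I) (auto simp: norm_mult inverse_eq_qcnj, simp_all add: norm_quat_def)
  then have "Tgrp \<subseteq> ?K"
    by (rule Tgrp_least) simp_all
  then show ?thesis
    using assms by blast
qed

lemma sqrt2_notin_Rats: "sqrt 2 \<notin> \<rat>"
proof
  assume "sqrt 2 \<in> \<rat>"
  then obtain m n :: nat where n: "n \<noteq> 0" and mn: "\<bar>sqrt 2\<bar> = real m / real n" "coprime m n"
    by (rule Rats_abs_nat_div_natE)
  then have "real m = sqrt 2 * real n"
    by simp
  then have "(real m)\<^sup>2 = 2 * (real n)\<^sup>2"
    by (simp add: power_mult_distrib)
  then have eq: "m\<^sup>2 = 2 * n\<^sup>2"
    by (metis of_nat_eq_iff of_nat_mult of_nat_numeral of_nat_power)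
  then have "even m"
    by (metis dvd_triv_left even_power)
  then obtain k where "m = 2 * k" ..
  with eq have "n\<^sup>2 = 2 * k\<^sup>2"
    by (simp add: power_mult_distrib)
  then have "even n"
    by (metis dvd_triv_left even_power)
  with \<open>even m\<close> mn(2) show False
    by (metis coprime_common_divisor_nat numeral_One numeral_eq_iff semiring_norm(85))
qed

lemma delta_notin_Tgrp: "delta \<notin> Tgrp"
proof
  assume "delta \<in> Tgrp"
  then have "1 / sqrt 2 \<in> \<rat>"
    using Tgrp_rational_QIm1 by fastforce
  then have "inverse (1 / sqrt 2) \<in> \<rat>"
    by (rule Rats_inverse)
  then show False
    using sqrt2_notin_Rats by simp
qed

text \<open>Makes the two cosets in \<open>Ogrp\<close> disjoint, so that \<open>beta\<close>
  changes the sign on all of the second one.\<close>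

lemma mult_delta_notin_Tgrp:
  assumes "x \<in> Tgrp"
  shows "x * delta \<notin> Tgrp"
proof
  assume "x * delta \<in> Tgrp"
  with Tgrp_closed(4)[OF assms] have "inverse x * (x * delta) \<in> Tgrp"
    by (rule Tgrp_closed(3))
  moreover have "x \<noteq> 0"
    using Tgrp_closed(2)[OF assms] by auto
  ultimately have "delta \<in> Tgrp"
    by (simp flip: mult.assoc)
  then show False
    using delta_notin_Tgrp by contradiction
qed

text \<open>The union is a subgroup because \<open>delta\<close> normalises \<open>Tgrp\<close> and
  \<open>delta * delta = - 1\<close> lies in it. It equals \<open>Ogrp\<close> because
  \<open>gamma\<close> and \<open>delta\<close> differ by a factor from \<open>Tgrp\<close>.\<close>

lemma Ogrp_eq: "Ogrp = Tgrp \<union> (\<lambda>x. x * delta) ` Tgrp"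
proof
  \<comment> \<open>This is \<open>delta * inverse gamma\<close>, written as a word in the
    generators of \<open>Tgrp\<close>.\<close>
  define t where "t = qi * inverse varpi * qi"
  have t: "t \<in> Tgrp"
    unfolding t_def by (intro Tgrp_closed Tgrp_gens)
  have delta: "delta = t * gamma"
    by (simp add: t_def inverse_eq_qcnj quat_eq_iff)
  have TO: "Tgrp \<subseteq> Ogrp"
    by (rule Tgrp_least[OF subgroup_Ogrp]) (auto simp: Ogrp_def intro: generate.incl)
  have "gamma \<in> Ogrp"
    by (auto simp: Ogrp_def intro: generate.incl)
  then have "delta \<in> Ogrp"
    unfolding delta using t TO by (auto intro: Ogrp_closed)
  then show "Tgrp \<union> (\<lambda>x. x * delta) ` Tgrp \<subseteq> Ogrp"
    using TO by (auto intro: Ogrp_closed)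
  have d0: "delta \<noteq> 0"
    by (simp add: quat_eq_iff)
  have nd: "norm delta = 1"
    by (simp add: norm_quat_def power_divide)
  let ?K = "Tgrp \<union> (\<lambda>x. x * delta) ` Tgrp"
  have pull: "x * delta * y = x * (delta * y * inverse delta) * delta" for x y
    using d0 by (simp add: mult.assoc)
  have right: "x * delta \<in> ?K" if "x \<in> ?K" for x
  proof -
    have "y * delta * delta = - y" for y
      by (simp add: mult.assoc delta_square)
    then show ?thesis
      using that by (auto simp: Tgrp_uminus simp del: mult_minus_right)
  qed
  have mT: "x * y \<in> ?K" if "x \<in> ?K" "y \<in> Tgrp" for x y
  proof -
    have "x * delta * y \<in> ?K" if "x \<in> Tgrp" for x
      unfolding pull[of x y] using that \<open>y \<in> Tgrp\<close> by (auto intro!: imageI Tgrp_closed delta_conj_Tgrp)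
    then show ?thesis
      using that Tgrp_closed(3) by auto
  qed
  have "subgroup ?K S3"
  proof (rule subgroup_S3I)
    show "1 \<in> ?K"
      using Tgrp_closed(1) by simp
    show "norm x = 1" if "x \<in> ?K" for x
      using that nd Tgrp_closed(2) by (auto simp: norm_mult)
    show "x * y \<in> ?K" if "x \<in> ?K" "y \<in> ?K" for x y
      using that(2)
    proof
      assume "y \<in> (\<lambda>x. x * delta) ` Tgrp"
      then obtain z where z: "z \<in> Tgrp" "y = z * delta"
        by blast
      show ?thesis
        using right[OF mT[OF that(1) z(1)]] by (simp only: z(2) mult.assoc)
    qed (rule mT[OF that(1)])
    show "inverse x \<in> ?K" if "x \<in> ?K" for x
      using that
    proof
      assume "x \<in> (\<lambda>x. x * delta) ` Tgrp"
      then obtain y where y: "y \<in> Tgrp" "x = y * delta"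
        by blast
      then have "y \<noteq> 0"
        using Tgrp_closed(2) by fastforce
      \<comment> \<open>The inverse has \<open>delta\<close> on the left; this form exhibits it as
        an element of the coset times an element of \<open>Tgrp\<close>, as \<open>mT\<close>
        requires.\<close>
      then have "inverse x = (- 1) * delta * inverse y"
        using d0 by (simp add: y nonzero_inverse_mult_distrib inverse_delta)
      moreover have "(- 1) * delta \<in> ?K"
        using Tgrp_uminus Tgrp_closed(1) by blast
      ultimately show ?thesis
        using mT Tgrp_closed(4)[OF y(1)] by metis
    qed (simp add: Tgrp_closed)
  qed
  moreover have "gamma \<in> ?K"
  proof -
    have "t \<noteq> 0"
      using Tgrp_closed(2)[OF t] by auto
    then have "gamma = inverse t * delta"
      by (simp add: delta flip: mult.assoc)
    then show ?thesis
      using Tgrp_closed(4)[OF t] by blast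
  qed
  ultimately show "Ogrp \<subseteq> ?K"
    unfolding Ogrp_def
    by (intro group.generate_subgroup_incl[OF group_S3]) (auto simp: Tgrp_gens)
qed

section \<open>Explicit element lists of the two groups\<close>

lemma r_coset_S3: "H #>\<^bsub>S3\<^esub> x = (\<lambda>h. h * x) ` H"
  by (auto simp: r_coset_def)

lemma Ggrp_Tgrp_eq:
  defines "c \<equiv> \<lambda>x. delta * x * inverse delta"
  shows "Ggrp Tgrp C2 (rho C2 delta) =
    (\<lambda>x. diag2 x (c x)) ` Tgrp \<union> (\<lambda>x. diag2 x (- c x)) ` Tgrp \<union>
    ((\<lambda>x. diag2 x (c x) ** swap2) ` Tgrp \<union> (\<lambda>x. diag2 x (- c x) ** swap2) ` Tgrp)"
proof -
  \<comment> \<open>The representatives \<open>x\<close> and \<open>- x\<close> contribute the same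
    coset, so the union in \<open>rho\<close> collapses.\<close>
  have "rho C2 delta (C2 #>\<^bsub>S3\<^esub> x) = {c x, - c x}" for x
    by (auto simp: rho_def r_coset_S3 C2_def c_def)
  then have coset: "rho C2 delta (C2 #>\<^bsub>S3\<^esub> x) = C2 #>\<^bsub>S3\<^esub> y \<longleftrightarrow> y = c x \<or> y = - c x" for x y
    by (auto simp: r_coset_S3 C2_def doubleton_eq_iff)
  have "c x \<in> Tgrp" "- c x \<in> Tgrp" if "x \<in> Tgrp" for x
    using delta_conj_Tgrp[OF that] by (simp_all add: c_def Tgrp_uminus del: mult_minus_right)
  then have "{diag2 x y | x y. x \<in> Tgrp \<and> y \<in> Tgrp \<and> rho C2 delta (C2 #>\<^bsub>S3\<^esub> x) = C2 #>\<^bsub>S3\<^esub> y}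
    = (\<lambda>x. diag2 x (c x)) ` Tgrp \<union> (\<lambda>x. diag2 x (- c x)) ` Tgrp"
    unfolding coset by blast
  then show ?thesis
    unfolding Ggrp_def Let_def by (simp only: image_Un image_image)
qed

text \<open>Cosets of the trivial group are singletons, so the second diagonal entry is
  \<open>beta x\<close>; the list splits according to the two cosets of \<open>Tgrp\<close>.\<close>

lemma Ggrp_Ogrp_eq:
  "Ggrp Ogrp {1} (image beta) =
    (\<lambda>x. diag2 x x) ` Tgrp \<union> (\<lambda>x. diag2 (x * delta) (- (x * delta))) ` Tgrp \<union>
    ((\<lambda>x. diag2 x x ** swap2) ` Tgrp \<union> (\<lambda>x. diag2 (x * delta) (- (x * delta)) ** swap2) ` Tgrp)"
proof -
  have T: "x \<in> Ogrp" "beta x = x" if "x \<in> Tgrp" for x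
    using that by (auto simp: Ogrp_eq beta_def)
  have Td: "x * delta \<in> Ogrp" "- (x * delta) \<in> Ogrp" "beta (x * delta) = - (x * delta)"
    if "x \<in> Tgrp" for x
  proof -
    show "x * delta \<in> Ogrp" "beta (x * delta) = - (x * delta)"
      using that mult_delta_notin_Tgrp by (auto simp: Ogrp_eq beta_def)
    have "- (x * delta) = (- x) * delta" "- x \<in> Tgrp"
      using that by (simp_all add: Tgrp_uminus)
    then show "- (x * delta) \<in> Ogrp"
      unfolding Ogrp_eq by blast
  qed
  have "{diag2 x y | x y. x \<in> Ogrp \<and> y \<in> Ogrp \<and> beta ` ({1} #>\<^bsub>S3\<^esub> x) = {1} #>\<^bsub>S3\<^esub> y}
    = (\<lambda>x. diag2 x (beta x)) ` {x \<in> Ogrp. beta x \<in> Ogrp}"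
    by (auto simp: r_coset_S3)
  also have "{x \<in> Ogrp. beta x \<in> Ogrp} = Tgrp \<union> (\<lambda>x. x * delta) ` Tgrp"
  proof -
    have "beta x \<in> Ogrp" if "x \<in> Ogrp" for x
      using that[unfolded Ogrp_eq] by (elim UnE imageE) (simp_all add: T Td)
    then show ?thesis
      using Ogrp_eq by blast
  qed
  also have "(\<lambda>x. diag2 x (beta x)) ` (Tgrp \<union> (\<lambda>x. x * delta) ` Tgrp)
    = (\<lambda>x. diag2 x x) ` Tgrp \<union> (\<lambda>x. diag2 (x * delta) (- (x * delta))) ` Tgrp"
    unfolding image_Un image_image using T Td by (intro arg_cong2[of _ _ _ _ "(\<union>)"] image_cong) auto
  finally show ?thesis
    unfolding Ggrp_def Let_def by (simp only: image_Un image_image)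
qed

section \<open>The conjugating matrix and its action\<close>

text \<open>The product of the real reflection and \<open>diag2 1 (inverse delta)\<close>, with
  \<open>inverse delta\<close> replaced by \<open>- delta\<close>.\<close>

definition conjugator :: "quat ^ 2 ^ 2" where
  "conjugator = vector [vector [(1 / sqrt 2) *\<^sub>R 1, - ((1 / sqrt 2) *\<^sub>R delta)],
                        vector [(1 / sqrt 2) *\<^sub>R 1, (1 / sqrt 2) *\<^sub>R delta]]"

lemma conjugator_nth [simp]:
  "conjugator $ 1 $ 1 = (1 / sqrt 2) *\<^sub>R 1" "conjugator $ 1 $ 2 = - ((1 / sqrt 2) *\<^sub>R delta)"
  "conjugator $ 2 $ 1 = (1 / sqrt 2) *\<^sub>R 1" "conjugator $ 2 $ 2 = (1 / sqrt 2) *\<^sub>R delta"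
  by (simp_all add: conjugator_def)

lemma qcnj_scaleR: "qcnj (r *\<^sub>R x) = r *\<^sub>R qcnj x" and qcnj_uminus: "qcnj (- x) = - qcnj x"
  and qcnj_delta: "qcnj delta = - delta"
  by (simp_all add: quat_eq_iff)

lemma qadjoint_conjugator_nth [simp]:
  "qadjoint conjugator $ 1 $ 1 = (1 / sqrt 2) *\<^sub>R 1"
  "qadjoint conjugator $ 1 $ 2 = (1 / sqrt 2) *\<^sub>R 1"
  "qadjoint conjugator $ 2 $ 1 = (1 / sqrt 2) *\<^sub>R delta"
  "qadjoint conjugator $ 2 $ 2 = - ((1 / sqrt 2) *\<^sub>R delta)"
  by (simp_all add: qadjoint_def qcnj_scaleR qcnj_uminus qcnj_delta)

lemma delta_mult_delta: "x * delta * delta = - x" "delta * (delta * x) = - x"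
  by (simp_all add: mult.assoc delta_square) (simp add: delta_square flip: mult.assoc)

text \<open>Each entry of a conjugated matrix is a sum of terms with factor \<open>1 / 2\<close>,
  the square of \<open>1 / sqrt 2\<close>; these rules recombine them.\<close>

lemma half_plus_half: "(1 / 2) *\<^sub>R x + (1 / 2) *\<^sub>R x = (x :: 'a :: real_vector)"
  and minus_half_minus_half: "- ((1 / 2) *\<^sub>R x) - (1 / 2) *\<^sub>R x = - x"
  by (simp_all flip: scaleR_add_left scaleR_minus_left scaleR_diff_left)

lemma conjugator_in_U2H: "conjugator \<in> carrier U2H"
  by (simp add: U2H_def vec_eq_iff forall_2 matrix_matrix_mult_def sum_2 mat_def
      delta_square half_plus_half)

text \<open>The second and fourth families trade places between diagonal and swapped form. In the
  third, \<open>diag2 1 (inverse delta)\<close> leaves \<open>x * delta\<close> times a right-angle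
  rotation, which the reflection, of determinant -1, turns into its negative; hence the
  \<open>- x\<close>.\<close>

lemma conjugator_diag2:
  defines "c \<equiv> \<lambda>x. delta * x * inverse delta"
  shows "conjugator ** diag2 x (c x) ** qadjoint conjugator = diag2 x x"
    "conjugator ** diag2 x (- c x) ** qadjoint conjugator = diag2 x x ** swap2"
    "conjugator ** (diag2 x (c x) ** swap2) ** qadjoint conjugator
      = diag2 (- x * delta) (- (- x * delta)) ** swap2"
    "conjugator ** (diag2 x (- c x) ** swap2) ** qadjoint conjugator
      = diag2 (x * delta) (- (x * delta))"
  by (simp_all add: vec_eq_iff forall_2 matrix_matrix_mult_def sum_2 c_def inverse_delta
      delta_mult_delta delta_square half_plus_half minus_half_minus_half mult.assoc)

theorem theorem7p1:
  shows "conjugate_in U2H (Ggrp Tgrp C2 (rho C2 delta)) (Ggrp Ogrp {1} (image beta))"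
proof -
  \<comment> \<open>Absorbs the sign in the third family, as \<open>Tgrp\<close> is closed under
    negation.\<close>
  have uminus: "f ` Tgrp = (\<lambda>x. f (- x)) ` Tgrp" for f :: "quat \<Rightarrow> quat ^ 2 ^ 2"
    by (auto simp: image_iff) (metis Tgrp_uminus minus_minus)+
  have "(\<lambda>A. conjugator ** A ** qadjoint conjugator) ` Ggrp Tgrp C2 (rho C2 delta)
    = (\<lambda>x. diag2 x x) ` Tgrp \<union> (\<lambda>x. diag2 x x ** swap2) ` Tgrp \<union>
      ((\<lambda>x. diag2 (- x * delta) (- (- x * delta)) ** swap2) ` Tgrp \<union>
       (\<lambda>x. diag2 (x * delta) (- (x * delta))) ` Tgrp)"
    unfolding Ggrp_Tgrp_eq image_Un image_image conjugator_diag2 ..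
  also have "\<dots> = Ggrp Ogrp {1} (image beta)"
    unfolding Ggrp_Ogrp_eq uminus[of "\<lambda>x. diag2 (x * delta) (- (x * delta)) ** swap2"]
    by blast
  finally have "Ggrp Ogrp {1} (image beta) =
      conjugator <#\<^bsub>U2H\<^esub> Ggrp Tgrp C2 (rho C2 delta) #>\<^bsub>U2H\<^esub> inv\<^bsub>U2H\<^esub> conjugator"
    unfolding inv_U2H[OF conjugator_in_U2H]
    by (auto simp: l_coset_def r_coset_def U2H_def)
  then show ?thesis
    unfolding conjugate_in_def using conjugator_in_U2H by blast
qed

end
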